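(* Let $F$ be a field of characteristic $p>0$ and let $n \in \mathbb{Z}^+$. For $1 \leq i \leq n$, let $X_i \subseteq F$ be finite and nonempty, and put $X := \prod_{i=1}^n X_i \subseteq F^n$. a) For all $\underline{k} = (k_1,\ldots,k_n) \in \mathbb{N}^n$ we have $\pi_{\underline{k}}(X) = \prod_{i=1}^n \pi_{k_i}(X_i)$. b) Let $J := \{1 \leq i \leq n \mid \# X_i \neq 1\}$. Then we have \[ \underline{\omega}(X) = \sum_{j \in J} \omega(X_j). \] c) If each $X_i \subseteq \mathbb{F}_q$ is Vandermonde of size divisible by $p$, then \[ \underline{\omega}(X) = \sum_{i=1}^n \left( \# X_i -1 \right), \] so $X$ is optimal.
   Context: Here $\mathbb{N}$ is the set of non-negative integers, $\mathbb{Z}^+$ is the set of positive integers, and $\mathbb{F}_q$ denotes a finite field of order $q$ and characteristic $p$ (in part c) the ambient field $F$ is $\mathbb{F}_q$). Let $F$ be a field of characteristic $p>0$, $n \in \mathbb{Z}^+$, and $X \subseteq F^n$ finite and nonempty. For $\underline{k} = (k_1,\ldots,k_n) \in \mathbb{N}^n$ put $|\underline{k}| := k_1+\ldots+k_n$ and \[ \pi_{\underline{k}}(X) := \sum_{(x_1,\ldots,x_n) \in X} x_1^{k_1}\cdots x_n^{k_n} \in F \] (with $x^0 = 1$ for all $x \in F$); for $n=1$ this is $\pi_k(Y) = \sum_{y \in Y} y^k$ for a finite nonempty $Y\subseteq F$. Two invariants are used. For finite nonempty $X \subseteq F^n$, define $\underline{\omega}(X) := \inf\{ |\underline{k}| \mid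 \underline{k} \in \mathbb{N}^n,\ \pi_{\underline{k}}(X) \neq 0\}$ (here $\underline{k} = \underline{0}$ is allowed). For a finite subset $Y \subset F$ with $\# Y \geq 2$, define $\omega(Y)$ to be the least $k \in \mathbb{Z}^+$ (so $k \geq 1$) such that $\pi_k(Y) \neq 0$; such a $k$ exists. A finite subset $Y \subset F$ with $\#Y \geq 2$ is called Vandermonde if $\omega(Y) = \# Y - 1$. A finite nonempty subset $X \subseteq F^n$ is called optimal if $\underline{\omega}(X) = \sum_{i=1}^n (\# X_i - 1)$, where $X_i$ denotes the projection of $X$ onto its $i$th coordinate.
   Formalization: Part b) is false as printed (p = 3, n = 1, X_1 = {0,1}: left side 0, right side 1); it is proved when p divides #X_j for all j in J, and for arbitrary X_i with the sum restricted to those j in J with p dividing #X_j. *)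

theory Defs
  imports "HOL-Analysis.Analysis"
begin

text \<open>
  Let \<open>F\<close> be a field, represented by a type \<open>'a :: field\<close>; its characteristic is \<open>CHAR('a)\<close>.
  The space \<open>F\<^sup>n\<close> is \<open>'a ^ 'n\<close> with \<open>n = CARD('n) \<ge> 1\<close>, and multi-exponents are elements of
  \<open>nat ^ 'n\<close>. The convention \<open>x ^ 0 = 1\<close>, also for \<open>x = 0\<close>, is that of the library.
\<close>

definition power_sum :: "nat \<Rightarrow> 'a::field set \<Rightarrow> 'a" where
  "power_sum k Y = (\<Sum>y\<in>Y. y ^ k)"

definition mpower_sum :: "nat ^ 'n \<Rightarrow> ('a::field ^ 'n) set \<Rightarrow> 'a" where
  "mpower_sum k X = (\<Sum>x\<in>X. \<Prod>i\<in>UNIV. (x $ i) ^ (k $ i))"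

definition total_degree :: "nat ^ 'n \<Rightarrow> nat" where
  "total_degree k = (\<Sum>i\<in>UNIV. k $ i)"

text \<open>
  \<open>omega\<close> minimises over positive exponents only, whereas \<open>omega_vec\<close> allows the zero
  exponent. They are meaningful for finite \<open>Y\<close> with at least two elements, respectively for
  finite nonempty \<open>X\<close>; in these cases the sets of exponents involved are nonempty.
\<close>

definition omega :: "'a::field set \<Rightarrow> nat" where
  "omega Y = (LEAST k. 1 \<le> k \<and> power_sum k Y \<noteq> 0)"

definition omega_vec :: "('a::field ^ 'n) set \<Rightarrow> nat" where
  "omega_vec X = Inf {total_degree k | k. mpower_sum k X \<noteq> 0}"

definition vandermonde :: "'a::field set \<Rightarrow> bool" where
  "vandermonde Y \<longleftrightarrow> finite Y \<and> card Y \<ge> 2 \<and> omega Y = card Y - 1"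

definition optimal :: "('a::field ^ 'n) set \<Rightarrow> bool" where
  "optimal X \<longleftrightarrow> finite X \<and> X \<noteq> {} \<and>
     omega_vec X = (\<Sum>i\<in>UNIV. card ((\<lambda>x. x $ i) ` X) - 1)"

text \<open>
  A pitfall for products \<open>X = \<Prod>\<^sub>i X\<^sub>i\<close>: since \<open>power_sum 0 Y\<close> is the image of \<open>card Y\<close> in the
  field, a factor whose cardinality is not divisible by the characteristic contributes \<open>0\<close> to
  \<open>omega_vec X\<close>, although \<open>omega\<close> of a factor with at least two elements is always positive.
  So \<open>omega_vec X\<close> is the sum of the \<open>omega (X\<^sub>j)\<close> over the \<open>j\<close> with \<open>card (X\<^sub>j) \<noteq> 1\<close> only if the
  characteristic divides \<open>card (X\<^sub>j)\<close> for all these \<open>j\<close>; for \<open>Y = {0, 1}\<close> in characteristic \<open>3\<close>,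
  \<open>omega Y = 1\<close> but the one-dimensional \<open>omega_vec\<close> is \<open>0\<close>.
\<close>

end

theory Submission
  imports Defs
begin

text \<open>
  By distributivity a power sum over a product is the product of the power sums of the factors,
  and it is nonzero iff every factor is. So the minimal total degree is attained by minimising
  each exponent separately, with minimum \<open>0\<close> for a factor whose cardinality is nonzero in the
  field and \<open>omega\<close> otherwise. The minimum exists since some positive power sum of a set \<open>Y\<close>
  containing a nonzero \<open>a\<close> does not vanish: otherwise the sum over \<open>Y\<close> of every polynomial
  without constant term would vanish, in particular that of \<open>x * (\<Prod>b\<in>Y - {a}. x - b)\<close>.
\<close>

lemma sum_poly_eq_power_sum:
  "(\<Sum>y\<in>Y. poly P y) = (\<Sum>k\<le>degree P. coeff P k * power_sum k Y)"
  unfolding poly_altdef power_sum_def sum_distrib_left by (rule sum.swap)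

lemma power_sum_0: "power_sum 0 Y = of_nat (card Y)"
  by (simp add: power_sum_def)

lemma ex_power_sum_neq_0:
  fixes Y :: "'a::field set"
  assumes "finite Y" "card Y \<ge> 2"
  shows "\<exists>k\<ge>1. power_sum k Y \<noteq> 0"
proof (rule ccontr)
  assume "\<not> ?thesis"
  then have zero: "power_sum k Y = 0" if "k \<noteq> 0" for k
    using that by (metis less_one linorder_not_less)
  have "\<not> Y \<subseteq> {0}"
    using card_mono[of "{0}" Y] assms(2) by auto
  then obtain a where a: "a \<in> Y" "a \<noteq> 0" by auto
  \<comment> \<open>The factor \<open>[:0, 1:]\<close> removes the constant term, since
    \<open>zero\<close> says nothing about exponent 0. The other factors vanish on \<open>Y\<close>
    except at \<open>a\<close>, so only \<open>poly P a\<close> survives in the sum.\<close>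
  define P where "P = [:0, 1:] * (\<Prod>b\<in>Y - {a}. [:- b, 1:])"
  have P: "poly P y = y * (\<Prod>b\<in>Y - {a}. y - b)" for y
    by (simp add: P_def poly_prod)
  have "coeff P 0 = 0"
    using P[of 0] by (simp add: poly_0_coeff_0)
  then have "coeff P k * power_sum k Y = 0" for k
    using zero by (cases "k = 0") auto
  then have "(\<Sum>y\<in>Y. poly P y) = 0"
    by (simp only: sum_poly_eq_power_sum sum.neutral_const)
  moreover have "(\<Sum>y\<in>Y. poly P y) = poly P a"
  proof -
    have "poly P y = 0" if "y \<in> Y - {a}" for y
      unfolding P using that assms(1) by auto
    then show ?thesis
      by (simp add: sum.remove[OF assms(1) a(1)])
  qed
  moreover have "poly P a \<noteq> 0"
    unfolding P using a assms(1) by auto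
  ultimately show False by simp
qed

text \<open>Extensionality outside \<open>UNIV\<close> is vacuous, so vectors and extensional
  functions match exactly. This carries distributivity and finiteness from function spaces over to
  vectors.\<close>

lemma bij_betw_vec_nth_PiE:
  "bij_betw vec_nth {x :: 'a ^ 'n::finite. \<forall>i. x $ i \<in> A i} (Pi\<^sub>E UNIV A)"
  by (rule bij_betw_byWitness[where f' = vec_lambda]) (auto simp: PiE_UNIV_domain)

lemma mpower_sum_Pi:
  fixes A :: "'n::finite \<Rightarrow> 'a::field set"
  assumes "\<And>i. finite (A i)"
  shows "mpower_sum k {x. \<forall>i. x $ i \<in> A i} = (\<Prod>i\<in>UNIV. power_sum (k $ i) (A i))"
proof -
  have "mpower_sum k {x. \<forall>i. x $ i \<in> A i} = (\<Sum>g\<in>Pi\<^sub>E UNIV A. \<Prod>i\<in>UNIV. g i ^ (k $ i))"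
    unfolding mpower_sum_def
    by (rule sum.reindex_bij_betw[OF bij_betw_vec_nth_PiE])
  also have "\<dots> = (\<Prod>i\<in>UNIV. power_sum (k $ i) (A i))"
    unfolding power_sum_def by (rule prod_sum_PiE[symmetric]) (use assms in auto)
  finally show ?thesis .
qed

lemma omega_vec_Pi:
  fixes A :: "'n::finite \<Rightarrow> 'a::field set"
  assumes fin: "\<And>i. finite (A i)" and ex: "\<And>i. \<exists>k. power_sum k (A i) \<noteq> 0"
  shows "omega_vec {x. \<forall>i. x $ i \<in> A i} = (\<Sum>i\<in>UNIV. LEAST k. power_sum k (A i) \<noteq> 0)"
proof -
  define m where "m i = (LEAST k. power_sum k (A i) \<noteq> 0)" for i
  have m: "power_sum (m i) (A i) \<noteq> 0" for i
    unfolding m_def using ex[of i] by (rule LeastI_ex)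
  have "Inf {total_degree k |k. mpower_sum k {x. \<forall>i. x $ i \<in> A i} \<noteq> 0} = sum m UNIV"
  proof (rule cInf_eq_minimum)
    show "sum m UNIV \<in> {total_degree k |k. mpower_sum k {x. \<forall>i. x $ i \<in> A i} \<noteq> 0}"
      by (intro CollectI exI[of _ "vec_lambda m"]) (simp add: total_degree_def mpower_sum_Pi fin m)
  next
    fix d assume "d \<in> {total_degree k |k. mpower_sum k {x. \<forall>i. x $ i \<in> A i} \<noteq> 0}"
    then show "sum m UNIV \<le> d"
      \<comment> \<open>A product that is nonzero has only nonzero factors, so each
        \<open>k $ i\<close> is itself a candidate for the minimum \<open>m i\<close>.\<close>
      by (auto simp: total_degree_def mpower_sum_Pi fin m_def intro!: sum_mono Least_le)
  qed
  then show ?thesis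
    by (simp add: omega_vec_def m_def)
qed

text \<open>Exponent 0 gives \<open>card Y\<close> in the field and wins unless the characteristic
  divides it; in that case requiring \<open>1 \<le> k\<close> excludes nothing. Both sides then
  minimise the same predicate, so existence of a minimiser is irrelevant.\<close>

lemma Least_power_sum:
  fixes Y :: "'a::field set"
  shows "(LEAST k. power_sum k Y \<noteq> 0) = (if CHAR('a) dvd card Y then omega Y else 0)"
proof (cases "CHAR('a) dvd card Y")
  case True
  then have "power_sum 0 Y = 0"
    by (simp add: power_sum_0 of_nat_eq_0_iff_char_dvd)
  then have "power_sum k Y \<noteq> 0 \<longleftrightarrow> 1 \<le> k \<and> power_sum k Y \<noteq> 0" for k
    by (cases k) auto
  then show ?thesis
    using True by (simp add: omega_def)
next
  case False
  then show ?thesis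
    by (simp add: power_sum_0 of_nat_eq_0_iff_char_dvd Least_eq_0)
qed

lemma image_vec_nth_Pi:
  fixes A :: "'n::finite \<Rightarrow> 'a set"
  assumes "\<And>i. A i \<noteq> {}"
  shows "(\<lambda>x. x $ i) ` {x. \<forall>i. x $ i \<in> A i} = A i"
proof
  obtain c where "\<forall>j. c j \<in> A j"
    using choice[of "\<lambda>j y. y \<in> A j"] assms by blast
  then have "y \<in> (\<lambda>x. x $ i) ` {x. \<forall>i. x $ i \<in> A i}" if "y \<in> A i" for y
    \<comment> \<open>Overwriting coordinate \<open>i\<close> of a point of the product by
      \<open>y\<close> stays in the product.\<close>
    using that by (intro image_eqI[of _ _ "vec_lambda (c(i := y))"]) auto
  then show "A i \<subseteq> (\<lambda>x. x $ i) ` {x. \<forall>i. x $ i \<in> A i}" by blast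
qed auto

text \<open>The formula of b) fails once some factor with at least two elements has cardinality not
  divisible by \<open>p\<close>: it contributes 0, while its \<open>omega\<close> is positive. Hence
  the divisibility premise, and next to it an unconditional version that sums over the divisible
  factors only.\<close>

theorem lemma3p3:
  fixes p :: nat
    and Xs :: "'n::finite \<Rightarrow> 'a::field set"
    and X :: "('a ^ 'n) set"
    and J :: "'n set"
  assumes char: "CHAR('a) = p" "p > 0"
    and fin: "\<And>i. finite (Xs i)"
    and nonempty: "\<And>i. Xs i \<noteq> {}"
    and X_def: "X = {x. \<forall>i. x $ i \<in> Xs i}"
    and J_def: "J = {i. card (Xs i) \<noteq> 1}"
  shows "(\<forall>k :: nat ^ 'n. mpower_sum k X = (\<Prod>i\<in>UNIV. power_sum (k $ i) (Xs i)))
    \<and> ((\<forall>j\<in>J. p dvd card (Xs j)) \<longrightarrow> omega_vec X = (\<Sum>j\<in>J. omega (Xs j)))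
    \<and> omega_vec X = (\<Sum>j | j \<in> J \<and> p dvd card (Xs j). omega (Xs j))
    \<and> (finite (UNIV :: 'a set) \<and> (\<forall>i. vandermonde (Xs i) \<and> p dvd card (Xs i)) \<longrightarrow>
         omega_vec X = (\<Sum>i\<in>UNIV. card (Xs i) - 1) \<and> optimal X)"
proof -
  have a: "mpower_sum k X = (\<Prod>i\<in>UNIV. power_sum (k $ i) (Xs i))" for k
    unfolding X_def using fin by (rule mpower_sum_Pi)
  have ex: "\<exists>k. power_sum k (Xs i) \<noteq> 0" for i
  proof (cases "card (Xs i) = 1")
    case True
    then have "power_sum 0 (Xs i) \<noteq> 0" by (simp add: power_sum_0)
    then show ?thesis ..
  next
    case False
    moreover have "card (Xs i) \<noteq> 0"
      using fin nonempty by simp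
    ultimately show ?thesis
      using ex_power_sum_neq_0[OF fin, of i] by force
  qed
  \<comment> \<open>Thus \<open>p\<close> does not divide the cardinality of a singleton, and
    divisibility alone puts an index into \<open>J\<close>.\<close>
  have "p \<noteq> 1"
    using char(1) CHAR_not_1[where ?'a = 'a] by auto
  then have J: "j \<in> J" if "p dvd card (Xs j)" for j
    using that by (auto simp: J_def)
  have "omega_vec X = (\<Sum>j\<in>UNIV. if p dvd card (Xs j) then omega (Xs j) else 0)"
    unfolding X_def omega_vec_Pi[OF fin ex] Least_power_sum char(1) ..
  also have "\<dots> = (\<Sum>j | j \<in> J \<and> p dvd card (Xs j). omega (Xs j))"
    using J by (subst sum.inter_filter[symmetric]) (auto intro: sum.cong)
  finally have b: "omega_vec X = (\<Sum>j | j \<in> J \<and> p dvd card (Xs j). omega (Xs j))" .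
  have b': "omega_vec X = (\<Sum>j\<in>J. omega (Xs j))" if "\<forall>j\<in>J. p dvd card (Xs j)"
    unfolding b using that by (intro sum.cong) auto
  have c: "omega_vec X = (\<Sum>i\<in>UNIV. card (Xs i) - 1)"
    if "\<forall>i. vandermonde (Xs i) \<and> p dvd card (Xs i)"
    unfolding b using that J by (intro sum.cong) (auto simp: vandermonde_def)
  have "finite X"
    unfolding X_def bij_betw_finite[OF bij_betw_vec_nth_PiE] using fin by (intro finite_PiE) auto
  \<comment> \<open>\<open>optimal\<close> speaks of the projections of \<open>X\<close>, which have
    to be identified with the given factors.\<close>
  moreover have proj: "(\<lambda>x. x $ i) ` X = Xs i" for i
    unfolding X_def using nonempty by (rule image_vec_nth_Pi)
  moreover have "X \<noteq> {}"
    using proj nonempty by force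
  ultimately have "optimal X" if "omega_vec X = (\<Sum>i\<in>UNIV. card (Xs i) - 1)"
    using that by (simp add: optimal_def)
  with a b b' c show ?thesis by blast
qed

end
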